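(* Let $\bar f_j\in\mathbb{R}_+$ and $\underline f_j=-\bar f_j$ for $j\in\{1,\dots,n\}$, $\underline f_0\le\bar f_0$, $d\in\mathbb{R}$, $x_0:=1$, and let $$\mathcal{S}=\Big\{(x,f)\in\{0,1\}^n\times\mathbb{R}^{n+1}:\ \sum_{j=0}^n f_j=d,\ \ \underline f_j x_j\le f_j\le \bar f_j x_j,\ j\in\{0,1,\dots,n\}\Big\}.$$ Define $$\mathcal{O}=\bigcup_{k=0}^n\Big\{(x,f)\in[0,1]^n\times\mathbb{R}^{n+1}:\ \sum_{j=0}^n f_j=d,\ \underline f_jx_j\le f_j\le\bar f_jx_j,\ j\in\{0,\dots,n\},\ f_k\in\operatorname{conv}(V_k),\ x_k=1\Big\}.$$ Then $\operatorname{conv}(\mathcal{S})\subseteq\operatorname{conv}(\mathcal{O})$.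
   Context: Coordinates: $x=(x_1,\dots,x_n)$ and $f=(f_0,\dots,f_n)$; $x_0$ is the constant $1$ (so for $k=0$ the condition $x_k=1$ holds automatically). Let $E_0=\{\underline f_0,\bar f_0\}$ and $E_j=\{-\bar f_j,0,\bar f_j\}$ for $j\in\{1,\dots,n\}$. For $k\in\{0,\dots,n\}$, $$V_k=\Big\{f_k=d-\sum_{j\in\{0,\dots,n\}\setminus\{k\}}f_j:\ f_j\in E_j\ \text{for } j\ne k,\ \ \underline f_k\le f_k\le\bar f_k\Big\}.$$ The convex hull of the empty set is empty. *)

theory Defs
  imports "HOL-Analysis.Analysis"
begin

(* The index set {1..n} is the finite type 'n, and {0..n} is 'n option: None is the index 0
   and Some i is an index i in {1..n}. Thus x ranges over R^n = real ^ 'n and f over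
   R^(n+1) = real ^ 'n option. The bounds are lo, hi (lower and upper), the demand is d. *)

(* x with the constant x_0 = 1 adjoined *)
definition ext :: "real ^ 'n \<Rightarrow> 'n option \<Rightarrow> real" where
  "ext x j = (case j of None \<Rightarrow> 1 | Some i \<Rightarrow> x $ i)"

definition feasible ::
  "('n::finite option \<Rightarrow> real) \<Rightarrow> ('n option \<Rightarrow> real) \<Rightarrow> real
     \<Rightarrow> real ^ 'n \<Rightarrow> real ^ 'n option \<Rightarrow> bool" where
  "feasible lo hi d x f \<longleftrightarrow>
     (\<Sum>j\<in>UNIV. f $ j) = d \<and>
     (\<forall>j. lo j * ext x j \<le> f $ j \<and> f $ j \<le> hi j * ext x j)"

definition Sset ::
  "('n::finite option \<Rightarrow> real) \<Rightarrow> ('n option \<Rightarrow> real) \<Rightarrow> real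
     \<Rightarrow> ((real ^ 'n) \<times> (real ^ 'n option)) set" where
  "Sset lo hi d = {(x, f). (\<forall>i. x $ i \<in> {0, 1}) \<and> feasible lo hi d x f}"

definition E ::
  "('n option \<Rightarrow> real) \<Rightarrow> ('n option \<Rightarrow> real) \<Rightarrow> 'n option \<Rightarrow> real set" where
  "E lo hi j = (case j of None \<Rightarrow> {lo None, hi None}
                        | Some i \<Rightarrow> {- hi (Some i), 0, hi (Some i)})"

definition V ::
  "('n::finite option \<Rightarrow> real) \<Rightarrow> ('n option \<Rightarrow> real) \<Rightarrow> real \<Rightarrow> 'n option \<Rightarrow> real set" where
  "V lo hi d k =
     {d - (\<Sum>j\<in>UNIV - {k}. f j) | f.
        (\<forall>j\<in>UNIV - {k}. f j \<in> E lo hi j) \<and>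
        lo k \<le> d - (\<Sum>j\<in>UNIV - {k}. f j) \<and> d - (\<Sum>j\<in>UNIV - {k}. f j) \<le> hi k}"

definition Oset ::
  "('n::finite option \<Rightarrow> real) \<Rightarrow> ('n option \<Rightarrow> real) \<Rightarrow> real
     \<Rightarrow> ((real ^ 'n) \<times> (real ^ 'n option)) set" where
  "Oset lo hi d =
     (\<Union>k. {(x, f). (\<forall>i. x $ i \<in> {0..1}) \<and> feasible lo hi d x f \<and>
                  f $ k \<in> convex hull (V lo hi d k) \<and> ext x k = 1})"

end

theory Submission
  imports Defs
begin

text \<open>Every point of the mixed-integer set has a binary \<open>x\<close>. Once this \<open>x\<close> is fixed, the admissible
  flows \<open>f\<close> form a compact convex polytope: a box cut by the hyperplane on which the coordinates sum
  to \<open>d\<close>. By the theorem of Minkowski such a polytope is the convex hull of its extreme points, so it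
  is enough to place each pair \<open>(x, f)\<close> with \<open>f\<close> extreme in the disjunctive set
  (\<open>feasible_extreme_in_Oset\<close>).

  An extreme point has at most one coordinate strictly between its bounds, because two such
  coordinates could be perturbed in opposite directions without leaving the hyperplane
  (\<open>extreme_point_slice_interior_unique\<close>). As \<open>x\<close> is binary, a bound is an element of \<open>E\<^sub>j\<close>: the
  number \<open>lo\<^sub>j\<close> or \<open>hi\<^sub>j\<close> if \<open>x\<^sub>j = 1\<close>, and \<open>0\<close> if \<open>x\<^sub>j = 0\<close>. Hence the exceptional coordinate \<open>k\<close>, being determined
  by the others through the sum, takes a value in \<open>V\<^sub>k\<close>. Moreover \<open>x\<^sub>k = 1\<close>, since \<open>x\<^sub>k = 0\<close> would
  make both bounds of \<open>f\<^sub>k\<close> equal; if there is no exceptional coordinate, \<open>k = 0\<close> serves, where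
  \<open>x\<^sub>0 = 1\<close> by convention.\<close>

definition box_slice :: "real ^ 'm \<Rightarrow> real ^ 'm \<Rightarrow> real \<Rightarrow> (real ^ 'm::finite) set" where
  "box_slice l u d = cbox l u \<inter> {f. (\<Sum>j\<in>UNIV. f $ j) = d}"

lemma mem_box_slice:
  "f \<in> box_slice l u d \<longleftrightarrow> (\<forall>j. l $ j \<le> f $ j \<and> f $ j \<le> u $ j) \<and> (\<Sum>j\<in>UNIV. f $ j) = d"
  by (simp add: box_slice_def mem_box_cart)

lemma box_slice_hyperplane:
  "{f :: real ^ 'm::finite. (\<Sum>j\<in>UNIV. f $ j) = d} = {f. inner (\<chi> j. 1) f = d}"
  by (simp add: inner_vec_def)

lemma compact_box_slice: "compact (box_slice l u d)"
  unfolding box_slice_def box_slice_hyperplane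
  by (intro compact_Int_closed compact_cbox closed_hyperplane)

lemma convex_box_slice: "convex (box_slice l u d)"
  unfolding box_slice_def box_slice_hyperplane
  by (intro convex_Int convex_box convex_hyperplane)

text \<open>If two coordinates \<open>i\<close> and \<open>j\<close> had slack on both sides, \<open>f\<close> would be the midpoint of the points
  obtained by moving a small amount \<open>e\<close> from \<open>i\<close> to \<open>j\<close> and from \<open>j\<close> to \<open>i\<close>.\<close>

lemma extreme_point_slice_interior_unique:
  fixes f :: "real ^ 'm::finite"
  assumes ext: "f extreme_point_of box_slice l u d"
    and i: "l $ i < f $ i" "f $ i < u $ i"
    and j: "l $ j < f $ j" "f $ j < u $ j"
  shows "i = j"
proof (rule ccontr)
  assume "i \<noteq> j"
  have f: "f \<in> box_slice l u d"
    using ext by (simp add: extreme_point_of_def)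
  define e where "e = Min {f $ i - l $ i, u $ i - f $ i, f $ j - l $ j, u $ j - f $ j}"
  have "e > 0"
    using i j by (simp add: e_def)
  have e: "e \<le> f $ i - l $ i" "e \<le> u $ i - f $ i" "e \<le> f $ j - l $ j" "e \<le> u $ j - f $ j"
    by (simp_all add: e_def)
  define v :: "real ^ 'm" where "v = axis i e - axis j e"
  have v: "v $ m = (if m = i then e else if m = j then - e else 0)" for m
    using \<open>i \<noteq> j\<close> by (auto simp: v_def axis_def)
  have sum_v: "(\<Sum>m\<in>UNIV. v $ m) = 0"
    by (simp add: v_def axis_def sum_subtractf)
  have plus: "f + v \<in> box_slice l u d" and minus: "f - v \<in> box_slice l u d"
    using f e \<open>e > 0\<close> sum_v by (auto simp: mem_box_slice v sum.distrib sum_subtractf)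
  have "v $ i \<noteq> 0"
    using \<open>e > 0\<close> by (simp add: v)
  then have "f + v \<noteq> f - v"
    by (auto simp: vec_eq_iff)
  then have "midpoint (f + v) (f - v) \<in> open_segment (f + v) (f - v)"
    by simp
  moreover have "midpoint (f + v) (f - v) = f"
    by (simp add: midpoint_def flip: scaleR_2)
  ultimately show False
    using ext plus minus by (auto simp: extreme_point_of_def)
qed

lemma feasible_iff_mem_box_slice:
  "feasible lo hi d x f \<longleftrightarrow>
     f \<in> box_slice (\<chi> j. lo j * ext x j) (\<chi> j. hi j * ext x j) d"
  by (auto simp: feasible_def mem_box_slice)

lemma ext_binary:
  assumes "\<And>i. x $ i \<in> {0, 1}"
  shows "ext x j \<in> {0, 1}"
  using assms by (auto simp: ext_def split: option.split)

lemma bound_in_E: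
  fixes lo hi :: "'n::finite option \<Rightarrow> real"
  assumes "\<And>i. lo (Some i) = - hi (Some i)"
    and "\<And>i. x $ i \<in> {0, 1}"
    and "y = lo j * ext x j \<or> y = hi j * ext x j"
  shows "y \<in> E lo hi j"
proof (cases j)
  case None
  then show ?thesis
    using assms(3) by (auto simp: E_def ext_def)
next
  case (Some i)
  then show ?thesis
    using assms(1)[of i] assms(2)[of i] assms(3) by (auto simp: E_def ext_def)
qed

lemma feasible_coord_in_V:
  assumes f: "feasible lo hi d x f" and k: "ext x k = 1"
    and E: "\<And>j. j \<noteq> k \<Longrightarrow> f $ j \<in> E lo hi j"
  shows "f $ k \<in> V lo hi d k"
proof -
  have "f $ k = d - (\<Sum>j\<in>UNIV - {k}. f $ j)"
    using f by (simp add: feasible_def sum.remove[of UNIV k])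
  moreover have "lo k \<le> f $ k" "f $ k \<le> hi k"
    using f k by (auto simp: feasible_def dest!: spec[of _ k])
  ultimately show ?thesis
    unfolding V_def using E by (auto intro!: exI[of _ "\<lambda>j. f $ j"])
qed

text \<open>The index of the disjunct is the coordinate strictly between its bounds, if there is one; an
  open gap between the bounds is what excludes \<open>x\<^sub>k = 0\<close> there. Otherwise every coordinate is at a
  bound and the index \<open>0\<close> is chosen.\<close>

lemma feasible_extreme_in_Oset:
  fixes lo hi :: "'n::finite option \<Rightarrow> real"
  assumes lo: "\<And>i. lo (Some i) = - hi (Some i)"
    and x: "\<And>i. x $ i \<in> {0, 1}"
    and extr: "f extreme_point_of {f. feasible lo hi d x f}"
  shows "(x, f) \<in> Oset lo hi d"
proof -
  have feas: "feasible lo hi d x f"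
    using extr by (simp add: extreme_point_of_def)
  define inner_coord where
    "inner_coord j \<longleftrightarrow> lo j * ext x j < f $ j \<and> f $ j < hi j * ext x j" for j
  have unique: "i = j" if "inner_coord i" "inner_coord j" for i j
    using extreme_point_slice_interior_unique[OF extr[unfolded feasible_iff_mem_box_slice Collect_mem_eq],
        of i j] that
    by (simp add: inner_coord_def)
  have at_bound: "f $ j \<in> E lo hi j" if "\<not> inner_coord j" for j
  proof -
    have "f $ j = lo j * ext x j \<or> f $ j = hi j * ext x j"
      using feas that by (auto simp: feasible_def inner_coord_def not_less intro: order_antisym)
    with lo x show ?thesis
      by (rule bound_in_E)
  qed
  obtain k where k: "ext x k = 1" and others: "\<And>j. j \<noteq> k \<Longrightarrow> \<not> inner_coord j"
  proof (cases "\<exists>k. inner_coord k")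
    case True
    then obtain k where "inner_coord k" ..
    moreover from this have "ext x k = 1"
      using ext_binary[OF x, of k] by (auto simp: inner_coord_def)
    ultimately show ?thesis
      using that unique by blast
  next
    case False
    then show ?thesis
      using that[of None] by (simp add: ext_def)
  qed
  have "f $ k \<in> convex hull V lo hi d k"
    using feasible_coord_in_V[OF feas k at_bound[OF others]] by (rule hull_inc)
  moreover have "x $ i \<in> {0..1}" for i
    using x[of i] by auto
  ultimately show ?thesis
    using feas k by (auto simp: Oset_def)
qed

theorem proposition5:
  fixes lo hi :: "'n::finite option \<Rightarrow> real" and d :: real
  assumes "\<And>i. 0 \<le> hi (Some i)"
    and "\<And>i. lo (Some i) = - hi (Some i)"
    and "lo None \<le> hi None"
  shows "convex hull (Sset lo hi d) \<subseteq> convex hull (Oset lo hi d)"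
proof (rule hull_minimal)
  show "Sset lo hi d \<subseteq> convex hull Oset lo hi d"
  proof (clarify)
    fix x f
    assume "(x, f) \<in> Sset lo hi d"
    then have x: "\<And>i. x $ i \<in> {0, 1}" and feas: "feasible lo hi d x f"
      by (auto simp: Sset_def)
    let ?P = "{f. feasible lo hi d x f}"
    have "?P = convex hull {g. g extreme_point_of ?P}"
      unfolding feasible_iff_mem_box_slice Collect_mem_eq
      by (rule Krein_Milman_Minkowski[OF compact_box_slice convex_box_slice])
    with feas have "f \<in> convex hull {g. g extreme_point_of ?P}"
      by blast
    \<comment> \<open>The fibre over the fixed \<open>x\<close> embeds affinely, so a convex combination of flows lifts to one
      of pairs.\<close>
    then have "(x, f) \<in> convex hull ({x} \<times> {g. g extreme_point_of ?P})"
      by (simp add: convex_hull_Times)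
    moreover have "{x} \<times> {g. g extreme_point_of ?P} \<subseteq> Oset lo hi d"
      using feasible_extreme_in_Oset[of lo hi x, OF assms(2) x] by auto
    ultimately show "(x, f) \<in> convex hull Oset lo hi d"
      using hull_mono by blast
  qed
qed (rule convex_convex_hull)

end
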